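(* For each $n\in\mathbb{N}$ let $z_n$ be the positive real root of the equation $z^{n+1}=(1+z)^n$. Then $$z_n\sim\frac{n}{\ln n-\ln\ln n}\quad\text{as } n\to\infty.$$
   Context: $\mathbb{N}=\{1,2,3,\dots\}$. For each $n\in\mathbb{N}$ the equation $z^{n+1}=(1+z)^n$ has exactly one positive real root, so $z_n$ is well defined. The notation $a_n\sim b_n$ means $a_n/b_n\to 1$ as $n\to\infty$. *)

theory Defs
  imports Complex_Main "HOL-Library.Landau_Symbols"
begin

definition pos_root :: "nat \<Rightarrow> real" where
  "pos_root n = (THE z. 0 < z \<and> z ^ (n + 1) = (1 + z) ^ n)"

text \<open>The following fact shows that the description above denotes.\<close>

lemma ex1_pos_root: "\<exists>!z::real. 0 < z \<and> z ^ (n + 1) = (1 + z) ^ n"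
proof -
  define f :: "real \<Rightarrow> real" where "f z = z * (z / (1 + z)) ^ n" for z
  have root_iff: "z ^ (n + 1) = (1 + z) ^ n \<longleftrightarrow> f z = 1" if "0 < z" for z
    using that by (simp add: f_def power_divide divide_eq_eq)
  have mono: "f x < f y" if "0 < x" "x < y" for x y
  proof -
    have "x / (1 + x) \<le> y / (1 + y)"
      using that by (simp add: divide_simps algebra_simps)
    then have "(x / (1 + x)) ^ n \<le> (y / (1 + y)) ^ n"
      using that by (intro power_mono) auto
    moreover have "0 < (x / (1 + x)) ^ n"
      using that by simp
    ultimately show ?thesis
      unfolding f_def using that by (intro mult_less_le_imp_less) auto
  qed
  have "f 1 \<le> 1"
    by (simp add: f_def power_divide)
  moreover have "1 \<le> f (2 ^ n)"
  proof -
    have "(1 / 2 :: real) \<le> 2 ^ n / (1 + 2 ^ n)"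
      by (simp add: le_divide_eq add_pos_pos)
    then have "(1 / 2 :: real) ^ n \<le> (2 ^ n / (1 + 2 ^ n)) ^ n"
      by (intro power_mono) auto
    then have "(2::real) ^ n * (1 / 2) ^ n \<le> f (2 ^ n)"
      unfolding f_def by (intro mult_left_mono) auto
    then show ?thesis
      by (simp add: power_divide)
  qed
  moreover have "continuous_on {1..2 ^ n} f"
    unfolding f_def by (intro continuous_intros) auto
  ultimately obtain z where z: "1 \<le> z" "f z = 1"
    using IVT'[of f 1 1 "2 ^ n"] by auto
  show ?thesis
  proof (rule ex1I[of _ z])
    show "0 < z \<and> z ^ (n + 1) = (1 + z) ^ n"
      using z root_iff[of z] by auto
    show "y = z" if "0 < y \<and> y ^ (n + 1) = (1 + y) ^ n" for y
      using that z root_iff[of y] mono[of y z] mono[of z y] by (cases y z rule: linorder_cases) auto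
  qed
qed

end

theory Submission
  imports Defs "HOL-Real_Asymp.Real_Asymp"
begin

text \<open>
  On logarithmic scale the equation reads \<open>n ln (1 + 1/z) = ln z\<close>, where the left side is decreasing
  and the right side increasing in \<open>z\<close>; so an upper (lower) bound for the root is certified by the sign of
  the difference at a single point. With \<open>D = ln n - ln (ln n)\<close>, the difference at \<open>c n / D\<close> is
  \<open>(1/c - 1) D + O(1)\<close> for \<open>c\<close> near 1, so the points with \<open>c = 1 \<plusminus> 1 / sqrt (ln n)\<close> enclose the root:
  there the first term is of order \<open>sqrt (ln n)\<close>.
\<close>

lemma pos_root_pos: "0 < pos_root n"
  and pos_root_eq: "pos_root n ^ (n + 1) = (1 + pos_root n) ^ n"
  using theI'[OF ex1_pos_root[of n]] by (auto simp: pos_root_def)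

text \<open>Take logarithms of the defining equation and subtract \<open>n ln z\<close> from both
  sides.\<close>

lemma pos_root_ln_eq: "real n * ln (1 + 1 / pos_root n) = ln (pos_root n)"
proof -
  let ?z = "pos_root n"
  have "real (n + 1) * ln ?z = real n * ln (1 + ?z)"
    using pos_root_eq[of n] pos_root_pos[of n] by (metis ln_realpow add_pos_pos zero_less_one)
  moreover have "ln (1 + 1 / ?z) = ln (1 + ?z) - ln ?z"
    using pos_root_pos[of n] ln_div[of "1 + ?z" ?z] by (simp add: add_divide_distrib add.commute)
  ultimately show ?thesis
    by (simp only: right_diff_distrib) (simp add: distrib_right)
qed

lemma mult_ln_one_plus_inverse_antimono:
  fixes x y :: real
  assumes "0 < x" "x \<le> y"
  shows "real n * ln (1 + 1 / y) \<le> real n * ln (1 + 1 / x)"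
  using assms by (intro mult_left_mono) (auto simp: frac_le add_pos_pos)

lemma pos_root_le:
  assumes "0 < x" "real n * ln (1 + 1 / x) \<le> ln x"
  shows "pos_root n \<le> x"
proof (rule ccontr)
  assume "\<not> pos_root n \<le> x"
  then have "ln x < ln (pos_root n)"
    using assms by simp
  with mult_ln_one_plus_inverse_antimono[of x "pos_root n" n] pos_root_ln_eq[of n] assms
    \<open>\<not> pos_root n \<le> x\<close>
  show False by linarith
qed

lemma pos_root_ge:
  assumes "0 < x" "ln x \<le> real n * ln (1 + 1 / x)"
  shows "x \<le> pos_root n"
proof (rule ccontr)
  assume "\<not> x \<le> pos_root n"
  then have "ln (pos_root n) < ln x"
    using assms pos_root_pos[of n] by simp
  with mult_ln_one_plus_inverse_antimono[of "pos_root n" x n] pos_root_ln_eq[of n] pos_root_pos[of n]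
    assms \<open>\<not> x \<le> pos_root n\<close>
  show False by linarith
qed

theorem theorem2p6:
  shows "pos_root \<sim>[sequentially] (\<lambda>n. real n / (ln (real n) - ln (ln (real n))))"
proof -
  define a where "a n = real n / (ln (real n) - ln (ln (real n)))" for n
  define l where "l n = (1 - 1 / sqrt (ln (real n))) * a n" for n
  define u where "u n = (1 + 1 / sqrt (ln (real n))) * a n" for n
  have "eventually (\<lambda>n. 0 < l n) sequentially"
    unfolding l_def a_def by real_asymp
  \<comment> \<open>As \<open>ln D = ln (ln n) + o(1)\<close>, the left side is
    \<open>D + o(1)\<close>; the right side is \<open>n / l n + o(1)\<close>, larger by about
    \<open>sqrt (ln n)\<close>.\<close>
  moreover have "eventually (\<lambda>n. ln (l n) \<le> real n * ln (1 + 1 / l n)) sequentially"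
    unfolding l_def a_def by real_asymp
  ultimately have lower: "eventually (\<lambda>n. l n \<le> pos_root n) sequentially"
    by eventually_elim (rule pos_root_ge)
  have "eventually (\<lambda>n. 0 < u n) sequentially"
    unfolding u_def a_def by real_asymp
  moreover have "eventually (\<lambda>n. real n * ln (1 + 1 / u n) \<le> ln (u n)) sequentially"
    unfolding u_def a_def by real_asymp
  ultimately have upper: "eventually (\<lambda>n. pos_root n \<le> u n) sequentially"
    by eventually_elim (rule pos_root_le)
  \<comment> \<open>The margin \<open>1 / sqrt (ln n)\<close> tends to 0, so both factors tend to
    1.\<close>
  have "l \<sim>[sequentially] a" "u \<sim>[sequentially] a"
    unfolding l_def u_def a_def by real_asymp+
  moreover have "eventually (\<lambda>n. pos_root n \<in> {l n..u n}) sequentially"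
    using lower upper by eventually_elim simp
  ultimately have "pos_root \<sim>[sequentially] a"
    by (rule asymp_equiv_sandwich_real)
  then show ?thesis
    by (simp add: a_def[abs_def])
qed

end
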